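(* Let $k\ge 1$ be an integer and let $G$ be a connected chordal graph. Then $G$ is a $k$-tree if and only if the reduced clique graph $C_r(G)$ and the $(k+1)$-line graph $\ell_{k+1}(G)$ are the same graph (same vertex set and same edge set).
   Context: All graphs are finite and simple. A $k$-tree is defined recursively: the complete graph on $k+1$ vertices is a $k$-tree, and a $k$-tree with $n+1$ vertices ($n\ge k+1$) is obtained from a $k$-tree with $n$ vertices by adding a new vertex adjacent exactly to the vertices of some $k$-clique of it. For maximal cliques $Q,Q'$ of a chordal graph $G$, they form a separating pair if $Q\cap Q'\neq\emptyset$ and every path in $G$ from a vertex of $Q\setminus Q'$ to a vertex of $Q'\setminus Q$ contains a vertex of $Q\cap Q'$. The reduced clique graph $C_r(G)$ is the graph whose vertices are the maximal cliques of $G$ (as vertex subsets) and whose edges join pairs of maximal cliques forming separating pairs. For an integer $j\ge 2$, the $j$-line graph $\ell_j(G)$ is the graph whose vertices are the $j$-cliques of $G$ (vertex subsets of size $j$ inducing complete graphs), two being adjacent iff they share exactly $j-1$ vertices. *)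

theory Defs
  imports "Graph_Theory.Graph_Theory"
begin

text \<open>
  A finite simple graph is a \<^locale>\<open>pair_graph\<close>: an undirected edge between \<open>u\<close> and \<open>v\<close> is
  represented by the two arcs \<open>(u, v)\<close> and \<open>(v, u)\<close>. Equality of such records is therefore
  equality of vertex sets together with equality of edge sets.
\<close>

definition clique :: "'a pair_pre_digraph \<Rightarrow> 'a set \<Rightarrow> bool" where
  "clique G Q \<longleftrightarrow> Q \<subseteq> pverts G \<and> pairwise (\<lambda>u v. (u, v) \<in> parcs G) Q"

definition maximal_clique :: "'a pair_pre_digraph \<Rightarrow> 'a set \<Rightarrow> bool" where
  "maximal_clique G Q \<longleftrightarrow> clique G Q \<and> (\<forall>Q'. clique G Q' \<and> Q \<subseteq> Q' \<longrightarrow> Q' = Q)"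

text \<open>
  Every cycle of length at least four has a chord. The bound on the length also excludes the
  degenerate cycles \<open>u, v, u\<close> that \<^const>\<open>pre_digraph.cycle\<close> admits in a symmetric digraph.
\<close>
definition chordal :: "'a pair_pre_digraph \<Rightarrow> bool" where
  "chordal G \<longleftrightarrow>
    (\<forall>p. pre_digraph.cycle (with_proj G) p \<and> 4 \<le> length p \<longrightarrow>
      (\<exists>u \<in> fst ` set p. \<exists>v \<in> fst ` set p.
        (u, v) \<in> parcs G \<and> (u, v) \<notin> set p \<and> (v, u) \<notin> set p))"

inductive k_tree :: "nat \<Rightarrow> 'a pair_pre_digraph \<Rightarrow> bool" for k :: nat where
  complete: "complete_digraph (k + 1) (with_proj G) \<Longrightarrow> k_tree k G"
| add_vertex: "k_tree k G \<Longrightarrow> clique G Q \<Longrightarrow> card Q = k \<Longrightarrow> v \<notin> pverts G \<Longrightarrow>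
    k_tree k \<lparr> pverts = insert v (pverts G), parcs = parcs G \<union> {v} \<times> Q \<union> Q \<times> {v} \<rparr>"

definition separating_pair :: "'a pair_pre_digraph \<Rightarrow> 'a set \<Rightarrow> 'a set \<Rightarrow> bool" where
  "separating_pair G Q Q' \<longleftrightarrow>
    Q \<inter> Q' \<noteq> {} \<and>
    (\<forall>u \<in> Q - Q'. \<forall>v \<in> Q' - Q. \<forall>p. pre_digraph.apath (with_proj G) u p v \<longrightarrow>
      set (pawalk_verts u p) \<inter> (Q \<inter> Q') \<noteq> {})"

definition reduced_clique_graph :: "'a pair_pre_digraph \<Rightarrow> 'a set pair_pre_digraph" where
  "reduced_clique_graph G =
    \<lparr> pverts = {Q. maximal_clique G Q},
      parcs = {(Q, Q'). maximal_clique G Q \<and> maximal_clique G Q' \<and> Q \<noteq> Q' \<and>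
        separating_pair G Q Q'} \<rparr>"

definition line_graph :: "nat \<Rightarrow> 'a pair_pre_digraph \<Rightarrow> 'a set pair_pre_digraph" where
  "line_graph j G =
    \<lparr> pverts = {Q. clique G Q \<and> card Q = j},
      parcs = {(Q, Q'). clique G Q \<and> card Q = j \<and> clique G Q' \<and> card Q' = j \<and>
        card (Q \<inter> Q') = j - 1} \<rparr>"

lemma pair_graphI:
  assumes "finite (pverts G)" "parcs G \<subseteq> pverts G \<times> pverts G" "sym (parcs G)" "irrefl (parcs G)"
  shows "pair_graph G"
proof -
  have "finite (parcs G)" using assms(1,2) by (meson finite_SigmaI finite_subset)
  with assms show ?thesis by unfold_locales (auto simp: symmetric_def irrefl_def)
qed

lemma pair_graph_k_tree: "k_tree k G \<Longrightarrow> pair_graph G"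
proof (induction rule: k_tree.induct)
  case (complete G)
  then show ?case by (simp add: complete_digraph_def pair_graphI_graph)
next
  case (add_vertex G Q v)
  interpret pair_graph G by (rule add_vertex.IH)
  have Q: "Q \<subseteq> pverts G" using add_vertex.hyps by (simp add: clique_def)
  have G: "parcs G \<subseteq> pverts G \<times> pverts G" using in_arcsD1 in_arcsD2 by auto
  have sym: "sym (parcs G)" using pair_sym_arcs by (simp add: symmetric_def)
  have irrefl: "irrefl (parcs G)" using no_loops' by (metis irreflI)
  show ?case
  proof (rule pair_graphI, simp_all only: pair_pre_digraph.simps)
    show "finite (insert v (pverts G))" using pair_finite_verts by simp
    show "parcs G \<union> {v} \<times> Q \<union> Q \<times> {v} \<subseteq> insert v (pverts G) \<times> insert v (pverts G)"
      using G Q by blast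
    show "sym (parcs G \<union> {v} \<times> Q \<union> Q \<times> {v})" using sym unfolding sym_def by blast
    show "irrefl (parcs G \<union> {v} \<times> Q \<union> Q \<times> {v})"
      using irrefl Q add_vertex.hyps(4) unfolding irrefl_def by blast
  qed
qed

lemma separating_pair_sym:
  assumes "pair_graph G" and "separating_pair G Q Q'"
  shows "separating_pair G Q' Q"
  unfolding separating_pair_def
proof (intro conjI ballI allI impI)
  show "Q' \<inter> Q \<noteq> {}" using assms(2) unfolding separating_pair_def by blast
next
  interpret pair_graph G by (rule assms(1))
  fix u v p assume *: "u \<in> Q' - Q" "v \<in> Q - Q'" "apath u p v"
  then have "apath v (rev_path p) u" by simp
  then have "set (pawalk_verts v (rev_path p)) \<inter> (Q \<inter> Q') \<noteq> {}"
    using assms(2) * unfolding separating_pair_def by blast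
  moreover have "pawalk_verts v (rev_path p) = rev (pawalk_verts u p)"
    using * awalk_verts_rev_path[of u p v] by (simp add: apath_def)
  ultimately show "set (pawalk_verts u p) \<inter> (Q' \<inter> Q) \<noteq> {}"
    by (simp add: Int_commute)
qed

lemma finite_cliques:
  assumes "pair_graph G"
  shows "finite {Q. clique G Q}"
proof (rule finite_subset)
  show "{Q. clique G Q} \<subseteq> Pow (pverts G)" by (auto simp: clique_def)
  show "finite (Pow (pverts G))"
    using pair_fin_digraph.pair_finite_verts assms
    by (auto simp: pair_graph_def pair_digraph_def)
qed

lemma pair_graph_reduced_clique_graph:
  assumes "pair_graph G"
  shows "pair_graph (reduced_clique_graph G)"
proof (rule pair_graphI)
  show "finite (pverts (reduced_clique_graph G))"
    by (rule finite_subset[OF _ finite_cliques[OF assms]])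
      (auto simp: reduced_clique_graph_def maximal_clique_def)
  show "sym (parcs (reduced_clique_graph G))"
    by (rule symI) (use separating_pair_sym[OF assms] in \<open>force simp: reduced_clique_graph_def\<close>)
qed (auto simp: reduced_clique_graph_def irrefl_def)

lemma pair_graph_line_graph:
  assumes "pair_graph G" and "1 \<le> j"
  shows "pair_graph (line_graph j G)"
proof (rule pair_graphI)
  show "finite (pverts (line_graph j G))"
    by (rule finite_subset[OF _ finite_cliques[OF assms(1)]]) (auto simp: line_graph_def)
  show "sym (parcs (line_graph j G))"
    by (rule symI) (simp add: line_graph_def Int_commute)
qed (use assms(2) in \<open>auto simp: line_graph_def irrefl_def\<close>)

end

theory Submission
  imports Defs
begin

text \<open>
  If \<open>G\<close> is a k-tree, induction over its construction shows that its maximal cliques are its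
  (k+1)-cliques, that every separator has at least \<open>k\<close> vertices, and that two (k+1)-cliques
  sharing \<open>k\<close> vertices are separated by these. Conversely, let the two graphs be equal, let \<open>G\<close> be
  incomplete, and let \<open>v\<close> be a simplicial vertex with closed neighbourhood \<open>Q\<close>. Chordality gives,
  in a component of \<open>G - Q\<close>, a vertex adjacent to all attachments \<open>S\<close> of that component, so \<open>Q\<close>
  forms a separating pair with a maximal clique meeting \<open>Q\<close> in \<open>S\<close>. Hence \<open>S\<close> has \<open>k\<close> elements, so
  it is the neighbourhood of \<open>v\<close>; the hypotheses are inherited by \<open>G - v\<close>, and \<open>v\<close> is added back to
  the k-tree \<open>G - v\<close> along \<open>S\<close>.
\<close>

section \<open>Cliques, chordality and separation for edge relations\<close>

abbreviation complete_on :: "'a rel \<Rightarrow> 'a set \<Rightarrow> bool" where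
  "complete_on E Q \<equiv> pairwise (\<lambda>u v. (u, v) \<in> E) Q"

text \<open>
  This form of chordality depends on the edge relation only, so it is inherited by all induced
  subgraphs without changing \<open>E\<close>.
\<close>
definition chordal_rel :: "'a rel \<Rightarrow> bool" where
  "chordal_rel E \<longleftrightarrow> (\<forall>x a b. (x, a) \<in> E \<longrightarrow> (x, b) \<in> E \<longrightarrow> a \<noteq> b \<longrightarrow>
    (a, b) \<in> (Restr E (insert a (insert b (- insert x (E `` {x})))))\<^sup>* \<longrightarrow> (a, b) \<in> E)"

text \<open>
  The witness \<open>A\<close> plays the role of the vertices reachable from \<open>X\<close> without entering \<open>S\<close>; having
  it as a set replaces path surgery in the inductions that add or delete a vertex.
\<close>
definition separated_by :: "'a rel \<Rightarrow> 'a set \<Rightarrow> 'a set \<Rightarrow> 'a set \<Rightarrow> bool" where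
  "separated_by E S X Y \<longleftrightarrow> 
    (\<exists>A. X \<subseteq> A \<and> A \<inter> (S \<union> Y) = {} \<and> E `` A \<subseteq> A \<union> S)"

section \<open>Chordality in terms of walks avoiding a closed neighbourhood\<close>

text \<open>In a walk of least length, a repeated vertex or an \<open>R\<close>-step skipping ahead
  would give a shorter walk. For symmetric \<open>R\<close> the path is therefore induced.\<close>

lemma shortest_walk:
  assumes "(a, b) \<in> R\<^sup>*"
  obtains f :: "nat \<Rightarrow> 'a" and n where "f 0 = a" "f n = b"
    "\<And>i. i < n \<Longrightarrow> (f i, f (Suc i)) \<in> R"
    "inj_on f {..n}"
    "\<And>i j. i \<le> n \<Longrightarrow> j \<le> n \<Longrightarrow> (f i, f j) \<in> R \<Longrightarrow> j \<le> Suc i"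
proof -
  define n where "n = (LEAST n. (a, b) \<in> R ^^ n)"
  have ex: "\<exists>n. (a, b) \<in> R ^^ n" using assms by (simp add: rtrancl_power)
  have n: "(a, b) \<in> R ^^ n" unfolding n_def using ex by (rule LeastI_ex)
  have min: "n \<le> m" if "(a, b) \<in> R ^^ m" for m
    unfolding n_def using that by (rule Least_le)
  obtain f where f: "f 0 = a" "f n = b" "\<And>i. i < n \<Longrightarrow> (f i, f (Suc i)) \<in> R"
    using n by (auto simp: relpow_fun_conv)
  have walk: "(f i, f (i + d)) \<in> R ^^ d" if "i + d \<le> n" for i d
    using that
  proof (induction d)
    case (Suc d)
    then have "(f i, f (i + d)) \<in> R ^^ d" "(f (i + d), f (i + Suc d)) \<in> R"
      using f(3)[of "i + d"] by auto
    then show ?case by auto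
  qed simp
  have pre: "(a, f i) \<in> R ^^ i" if "i \<le> n" for i using walk[of 0 i] that f by simp
  have post: "(f i, b) \<in> R ^^ (n - i)" if "i \<le> n" for i using walk[of i "n - i"] that f by simp
  have less: "f i \<noteq> f j" if "i < j" "j \<le> n" for i j
  proof
    assume "f i = f j"
    then have "(a, b) \<in> R ^^ (i + (n - j))"
      using pre[of i] post[of j] that unfolding relpow_add by auto
    then show False using min that by fastforce
  qed
  have "inj_on f {..n}"
    by (rule inj_onI) (metis atMost_iff less linorder_neqE_nat)
  moreover have "j \<le> Suc i" if "i \<le> n" "j \<le> n" "(f i, f j) \<in> R" for i j
  proof -
    have "(a, f j) \<in> R ^^ Suc i" using pre[of i] that by auto
    then have "(a, b) \<in> R ^^ (Suc i + (n - j))"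
      using post[of j] that unfolding relpow_add by blast
    then show ?thesis using min[of "Suc i + (n - j)"] that by linarith
  qed
  ultimately show ?thesis using that f by blast
qed

text \<open>If \<open>a\<close> and \<open>b\<close> were nonadjacent, a shortest walk between them,
  closed up through \<open>x\<close>, would be a chordless cycle: its interior avoids the neighbours
  of \<open>x\<close>, and a chord between path vertices would be a shortcut.\<close>

lemma chordal_imp_chordal_rel:
  assumes "pair_graph G" "chordal G"
  shows "chordal_rel (parcs G)"
  unfolding chordal_rel_def
proof (intro allI impI)
  interpret pair_graph G by (rule assms(1))
  fix x a b
  let ?E = "parcs G"
  let ?M = "insert a (insert b (- insert x (?E `` {x})))"
  assume xa: "(x, a) \<in> ?E" and xb: "(x, b) \<in> ?E" and ab: "a \<noteq> b"
    and walk: "(a, b) \<in> (Restr ?E ?M)\<^sup>*"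
  show "(a, b) \<in> ?E"
  proof (rule ccontr)
    assume nab: "(a, b) \<notin> ?E"
    obtain f n where f: "f 0 = a" "f n = b"
      and step: "\<And>i. i < n \<Longrightarrow> (f i, f (Suc i)) \<in> Restr ?E ?M"
      and inj: "inj_on f {..n}"
      and induced: "\<And>i j. i \<le> n \<Longrightarrow> j \<le> n \<Longrightarrow> (f i, f j) \<in> Restr ?E ?M \<Longrightarrow> j \<le> Suc i"
      using shortest_walk[OF walk] by metis
    have "n \<noteq> 0" using f ab by metis
    moreover have "n \<noteq> 1" using f step[of 0] nab by auto
    ultimately have n: "2 \<le> n" by simp
    have M: "f i \<in> ?M" if "i \<le> n" for i
      using that f step[of i] by (cases "i = n") auto
    have fx: "f i \<noteq> x" if "i \<le> n" for i
      using M[OF that] no_loops' xa xb by auto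
    have adj_x: "i = 0 \<or> i = n" if "i \<le> n" "(x, f i) \<in> ?E" for i
    proof -
      have "f i = f 0 \<or> f i = f n" using M that f by auto
      then show ?thesis using inj that by (auto dest: inj_onD)
    qed
    \<comment> \<open>\<open>q\<close> lists the arcs of the path and \<open>p\<close> closes it
      through \<open>x\<close>; with \<open>n + 2\<close> arcs, \<open>p\<close> has the length that
      \<open>chordal\<close> asks for.\<close>
    define q where "q = map (\<lambda>i. (f i, f (Suc i))) [0..<n]"
    define p where "p = q @ [(b, x), (x, a)]"
    have aV: "a \<in> pverts G" using xa in_arcsD2 by blast
    have "awalk a (map (\<lambda>i. (f i, f (Suc i))) [0..<m]) (f m)" if "m \<le> n" for m
      using that
    proof (induction m)
      case 0
      then show ?case using f aV by (simp add: awalk_Nil_iff)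
    next
      case (Suc m)
      then have "(f m, f (Suc m)) \<in> ?E" using step[of m] by simp
      then have "awalk (f m) [(f m, f (Suc m))] (f (Suc m))"
        using in_arcsD2 by (simp add: awalk_Cons_iff awalk_Nil_iff)
      then show ?case using Suc awalk_appendI by fastforce
    qed
    then have "awalk a q b" using f q_def by blast
    moreover have "awalk b [(b, x), (x, a)] a"
      using xa xb aV arcs_symmetric by (simp add: awalk_Cons_iff awalk_Nil_iff)
    ultimately have awalk: "awalk a p a" unfolding p_def by (rule awalk_appendI)
    have fst_q: "map fst q = map f [0..<n]" unfolding q_def by simp
    have "pawalk_verts a p = map f [0..<n] @ [b, x, a]"
      using fst_q by (simp add: awalk_verts_conv p_def)
    moreover have "map f [0..<n] = a # map f [1..<n]"
      using n f by (simp add: upt_conv_Cons)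
    moreover have "distinct (map f [1..<n] @ [b, x, a])"
    proof -
      have "distinct (map f [0..<Suc n])"
        by (simp only: distinct_map) (use inj in \<open>auto simp: inj_on_def\<close>)
      then have "distinct (a # map f [1..<n] @ [b])"
        using n f \<open>map f [0..<n] = _\<close> by simp
      moreover have "x \<notin> set (a # map f [1..<n] @ [b])"
        using fx[of 0] fx[of n] fx[OF less_imp_le_nat] f by (auto simp: eq_commute[of x])
      ultimately show ?thesis by auto
    qed
    ultimately have "distinct (tl (pawalk_verts a p))" by simp
    then have "cycle p" using awalk unfolding cycle_def p_def by auto
    moreover have "4 \<le> length p" using n unfolding p_def q_def by simp
    ultimately obtain u v where uv: "u \<in> fst ` set p" "v \<in> fst ` set p" "(u, v) \<in> ?E"
      "(u, v) \<notin> set p" "(v, u) \<notin> set p"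
      using assms(2) unfolding chordal_def by blast
    have "fst ` set p = insert x (f ` {..n})"
    proof -
      have "fst ` set q = f ` {..<n}"
        using fst_q by (metis atLeast_upt set_map)
      moreover have "{..n} = insert n {..<n}" by auto
      ultimately show ?thesis using f by (auto simp: p_def)
    qed
    then have u: "u = x \<or> (\<exists>i\<le>n. u = f i)" and v: "v = x \<or> (\<exists>i\<le>n. v = f i)"
      using uv by auto
    have arcs: "(x, a) \<in> set p" "(b, x) \<in> set p" by (auto simp: p_def)
    have consec: "(f i, f (Suc i)) \<in> set p" if "i < n" for i
      using that by (auto simp: p_def q_def)
    have x_chord: False if "w = f i" "i \<le> n" "(x, w) \<in> ?E" "(x, w) \<notin> set p" "(w, x) \<notin> set p" for w i
      using adj_x[of i] that arcs f by auto
    have "u \<noteq> v" using uv no_loops' by blast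
    have vu: "(v, u) \<in> ?E" using uv arcs_symmetric by blast
    consider (ux) "u = x" | (vx) "v = x" | (path) "\<exists>i\<le>n. u = f i" "\<exists>j\<le>n. v = f j"
      using u v by blast
    then show False
    proof cases
      case ux then show False using v \<open>u \<noteq> v\<close> x_chord uv by blast
    next
      case vx then show False using u \<open>u \<noteq> v\<close> x_chord uv vu by blast
    next
      case path
      then obtain i j where ij: "i \<le> n" "u = f i" "j \<le> n" "v = f j" by blast
      have "(f i, f j) \<in> Restr ?E ?M" "(f j, f i) \<in> Restr ?E ?M"
        using M[OF ij(1)] M[OF ij(3)] uv(3) vu unfolding ij by blast+
      then have "j \<le> Suc i" "i \<le> Suc j" using induced ij(1,3) by metis+
      moreover have "i \<noteq> j" using \<open>u \<noteq> v\<close> ij by auto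
      ultimately have "j = Suc i \<or> i = Suc j" by linarith
      then show False using consec[of i] consec[of j] ij uv by auto
    qed
  qed
qed

section \<open>Simplicial vertices and dominating vertices\<close>

lemma Restr_rtrancl_mem:
  assumes "(y, z) \<in> (Restr E W)\<^sup>*" "y \<in> W"
  shows "z \<in> W"
  using assms by (induction rule: rtrancl_induct) auto

lemma sym_rtrancl_Restr: "sym E \<Longrightarrow> (x, y) \<in> (Restr E W)\<^sup>* \<Longrightarrow> (y, x) \<in> (Restr E W)\<^sup>*"
  by (rule symD[OF sym_rtrancl]) (auto simp: sym_def)

text \<open>Walks from \<open>y\<close> in \<open>W\<close> never leave \<open>C\<close>; by
  symmetry any two vertices of \<open>C\<close> are joined through \<open>y\<close>.\<close>

lemma reachable_connected:
  assumes "sym E" "C = (Restr E W)\<^sup>* `` {y}" "c \<in> C" "d \<in> C"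
  shows "(c, d) \<in> (Restr E C)\<^sup>*"
proof -
  have from_y: "(y, z) \<in> (Restr E C)\<^sup>*" if "(y, z) \<in> (Restr E W)\<^sup>*" for z
    using that
  proof (induction rule: rtrancl_induct)
    case (step u v)
    then have "u \<in> C" "v \<in> C" using assms(2) by (auto intro: rtrancl_into_rtrancl)
    then have "(u, v) \<in> Restr E C" using step by auto
    then show ?case using step.IH by (rule rtrancl_into_rtrancl[rotated])
  qed simp
  have "(c, y) \<in> (Restr E C)\<^sup>*" "(y, d) \<in> (Restr E C)\<^sup>*"
    using assms from_y sym_rtrancl_Restr[OF assms(1)] by auto
  then show ?thesis by (rule rtrancl_trans)
qed

text \<open>The form in which chordality is applied: a detour from \<open>a\<close> to
  \<open>b\<close> with interior in a set \<open>W\<close> off the closed neighbourhood of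
  \<open>x\<close>.\<close>

lemma chordal_rel_walk:
  assumes "chordal_rel E" "sym E" "(x, a) \<in> E" "(x, b) \<in> E" "a \<noteq> b"
    and "(a, c) \<in> E" "(c, d) \<in> (Restr E W)\<^sup>*" "c \<in> W" "(d, b) \<in> E"
    and "W \<inter> insert x (E `` {x}) = {}"
  shows "(a, b) \<in> E"
proof -
  let ?R = "Restr E (insert a (insert b (- insert x (E `` {x}))))"
  have d: "d \<in> W" using assms Restr_rtrancl_mem by metis
  have "(a, c) \<in> ?R" "(d, b) \<in> ?R" using assms d by auto
  moreover have "(c, d) \<in> ?R\<^sup>*"
    by (rule rtrancl_mono[THEN subsetD, OF _ assms(7)]) (use assms in auto)
  ultimately have "(a, b) \<in> ?R\<^sup>*" by (meson converse_rtrancl_into_rtrancl rtrancl_into_rtrancl)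
  then show ?thesis using assms unfolding chordal_rel_def by blast
qed

text \<open>Dirac's theorem, strengthened for induction by placing the simplicial vertex away from a
  given \<open>x\<close>. The induction hypothesis is applied to a component \<open>C\<close> of the
  nonneighbours of \<open>x\<close> together with its attachments \<open>S\<close>, a set that omits
  \<open>x\<close>.\<close>

lemma simplicial_vertex_off_neighbourhood:
  assumes "finite V" "chordal_rel E" "sym E" "irrefl E"
    and "x \<in> V" "y \<in> V" "y \<noteq> x" "(x, y) \<notin> E"
  shows "\<exists>w\<in>V. w \<noteq> x \<and> (x, w) \<notin> E \<and> complete_on E (E `` {w} \<inter> V)"
  using assms(1,5-)
proof (induction "card V" arbitrary: V x y rule: less_induct)
  case less
  note sym = symD[OF assms(3)]
  define W where "W = V - insert x (E `` {x})"
  define C where "C = (Restr E W)\<^sup>* `` {y}"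
  have yW: "y \<in> W" using less.prems by (auto simp: W_def)
  have yC: "y \<in> C" by (simp add: C_def)
  have CW: "C \<subseteq> W" using yW Restr_rtrancl_mem unfolding C_def by fastforce
  define S where "S = V \<inter> E `` C \<inter> E `` {x}"
  define H where "H = C \<union> S"
  have nbr: "E `` {c} \<inter> V \<subseteq> H" if "c \<in> C" for c
  proof
    fix z assume z: "z \<in> E `` {c} \<inter> V"
    have cz: "(c, z) \<in> E" using z by simp
    have "z \<noteq> x" using cz sym that CW by (auto simp: W_def)
    show "z \<in> H"
    proof (cases "(x, z) \<in> E")
      case True
      then show ?thesis using cz z that by (auto simp: H_def S_def)
    next
      case False
      then have "z \<in> W" using z \<open>z \<noteq> x\<close> by (simp add: W_def)
      then have "(c, z) \<in> Restr E W" using cz that CW by auto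
      then show ?thesis using that by (auto simp: H_def C_def intro: rtrancl_into_rtrancl)
    qed
  qed
  \<comment> \<open>Two attachments are neighbours of \<open>x\<close> joined through
    \<open>C\<close>, so chordality at \<open>x\<close> makes them adjacent.\<close>
  have S: "complete_on E S"
  proof (rule pairwiseI)
    fix s t assume st: "s \<in> S" "t \<in> S" "s \<noteq> t"
    obtain c d where cd: "c \<in> C" "d \<in> C" "(c, s) \<in> E" "(d, t) \<in> E"
      using st by (auto simp: S_def)
    show "(s, t) \<in> E"
      by (rule chordal_rel_walk[OF assms(2,3), of x s t c d C])
        (use st cd sym CW reachable_connected[OF assms(3) C_def] in \<open>auto simp: S_def W_def\<close>)
  qed
  have HV: "H \<subseteq> V - {x}" using CW irreflD[OF assms(4)] by (auto simp: H_def S_def W_def)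
  have fin: "finite H" using HV less.prems finite_subset by blast
  have card: "card H < card V"
    using HV less.prems by (intro psubset_card_mono) auto
  \<comment> \<open>A vertex of \<open>C\<close> has all its neighbours in \<open>H\<close>, so
    being simplicial in \<open>H\<close> suffices.\<close>
  have lift: ?case if w: "w \<in> C" "complete_on E (E `` {w} \<inter> H)" for w
  proof -
    have "E `` {w} \<inter> V = E `` {w} \<inter> H" using nbr[OF w(1)] HV by auto
    then show ?thesis using w CW by (intro bexI[of _ w]) (auto simp: W_def)
  qed
  show ?case
  proof (cases "\<exists>s\<in>S. \<exists>t\<in>H. t \<noteq> s \<and> (s, t) \<notin> E")
    case True
    then obtain s t where st: "s \<in> S" "t \<in> H" "t \<noteq> s" "(s, t) \<notin> E" by blast
    \<comment> \<open>Now \<open>s\<close> plays the role of \<open>x\<close>; being nonadjacent to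
      \<open>s\<close>, \<open>w\<close> is outside the clique \<open>S\<close>.\<close>
    then obtain w where w: "w \<in> H" "w \<noteq> s" "(s, w) \<notin> E" "complete_on E (E `` {w} \<inter> H)"
      using less.hyps[OF card fin, of s t] by (auto simp: H_def)
    have "w \<in> C" using w st S by (auto simp: H_def pairwise_def)
    then show ?thesis using lift w by blast
  next
    case univ: False
    show ?thesis
    proof (cases "complete_on E H")
      case True
      then show ?thesis using lift[OF yC] by (auto simp: pairwise_def)
    next
      case False
      then obtain p q where pq: "p \<in> H" "q \<in> H" "q \<noteq> p" "(p, q) \<notin> E"
        by (auto simp: pairwise_def)
      \<comment> \<open>Every vertex of \<open>S\<close> is adjacent to the rest of
        \<open>H\<close>, so a nonneighbour of \<open>p\<close> lies in \<open>C\<close>.\<close>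
      then obtain w where w: "w \<in> H" "w \<noteq> p" "(p, w) \<notin> E" "complete_on E (E `` {w} \<inter> H)"
        using less.hyps[OF card fin, of p q] by auto
      have "w \<notin> S"
      proof
        assume "w \<in> S"
        then have "(w, p) \<in> E" using univ pq(1) w(2) by auto
        then show False using sym w(3) by simp
      qed
      then have "w \<in> C" using w by (simp add: H_def)
      then show ?thesis using lift w by blast
    qed
  qed
qed

lemma first_entry:
  assumes "(c, d) \<in> R\<^sup>*" "c \<notin> P" "d \<in> P"
  shows "\<exists>e f. (c, e) \<in> (Restr R (- P))\<^sup>* \<and> e \<notin> P \<and> (e, f) \<in> R \<and> f \<in> P"
proof (rule ccontr)
  assume no: "\<nexists>e f. (c, e) \<in> (Restr R (- P))\<^sup>* \<and> e \<notin> P \<and> (e, f) \<in> R \<and> f \<in> P"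
  have "(c, d) \<in> (Restr R (- P))\<^sup>* \<and> d \<notin> P"
    using assms(1)
  proof (induction rule: rtrancl_induct)
    case (step y z)
    then have "z \<notin> P" using no by blast
    then have "(y, z) \<in> Restr R (- P)" using step by auto
    then show ?case using step.IH \<open>z \<notin> P\<close> by (meson rtrancl_into_rtrancl)
  qed (use assms in auto)
  then show False using assms by simp
qed

text \<open>Induction on \<open>S\<close>: if the vertex \<open>c\<close> found so far misses the
  new \<open>s\<close>, it is replaced by the first neighbour \<open>f\<close> of \<open>s\<close>
  on a walk in \<open>C\<close> starting at \<open>c\<close>.\<close>

lemma dominating_vertex:
  assumes "chordal_rel E" "sym E"
    and conn: "\<And>c d. c \<in> C \<Longrightarrow> d \<in> C \<Longrightarrow> (c, d) \<in> (Restr E C)\<^sup>*" and "C \<noteq> {}"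
    and "finite S" "complete_on E S" "C \<inter> S = {}" "\<And>s. s \<in> S \<Longrightarrow> E `` {s} \<inter> C \<noteq> {}"
  shows "\<exists>c\<in>C. \<forall>s\<in>S. (c, s) \<in> E"
  using assms(5-)
proof (induction S rule: finite_induct)
  case empty
  then show ?case using \<open>C \<noteq> {}\<close> by blast
next
  case (insert s S)
  note sym = symD[OF assms(2)]
  obtain c where c: "c \<in> C" "\<forall>t\<in>S. (c, t) \<in> E"
    using insert by (auto simp: pairwise_insert)
  show ?case
  proof (cases "(c, s) \<in> E")
    case True
    then show ?thesis using c by blast
  next
    case False
    let ?P = "E `` {s}"
    obtain d where d: "d \<in> C" "d \<in> ?P" using insert.prems(3)[of s] by blast
    have "c \<notin> ?P" using False sym by blast
    then obtain e f where ef: "(c, e) \<in> (Restr (Restr E C) (- ?P))\<^sup>*" "e \<notin> ?P"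
      "(e, f) \<in> Restr E C" "f \<in> ?P"
      using first_entry[OF conn[OF c(1) d(1)] _ d(2)] by blast
    have eq: "Restr (Restr E C) (- ?P) = Restr E (C - ?P)" by auto
    have sC: "s \<notin> C" using insert.prems by auto
    have "(t, f) \<in> E" if t: "t \<in> S" for t
    \<comment> \<open>Both \<open>t\<close> and \<open>f\<close> are neighbours of \<open>s\<close>,
      and the walk from \<open>t\<close> over \<open>c\<close> and \<open>e\<close> to
      \<open>f\<close> has its interior off the closed neighbourhood of \<open>s\<close>.\<close>
    proof (rule chordal_rel_walk[OF assms(1,2), of s t f c e "C - ?P"])
      show "(s, t) \<in> E" using insert.prems insert.hyps t by (auto simp: pairwise_insert)
    qed (use t c ef eq sC insert.prems \<open>c \<notin> ?P\<close> sym in auto)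
    then show ?thesis using ef sym by (intro bexI[of _ f]) auto
  qed
qed

section \<open>Separation of cliques\<close>

lemma awalk_leaving_meets_separator:
  assumes "pair_graph G" "pre_digraph.awalk (with_proj G) u p v" "parcs G `` A \<subseteq> A \<union> S"
    and "u \<in> A" "v \<notin> A"
  shows "set (pawalk_verts u p) \<inter> S \<noteq> {}"
  using assms(2,4,5)
proof (induction p arbitrary: u)
  interpret pair_graph G by (rule assms(1))
  case Nil
  then show ?case by (auto simp: awalk_Nil_iff)
next
  interpret pair_graph G by (rule assms(1))
  case (Cons e p)
  have e: "e \<in> parcs G" "fst e = u" "awalk (snd e) p v"
    using Cons.prems by (auto simp: awalk_Cons_iff)
  then have "snd e \<in> A \<union> S" using assms(3) Cons.prems(2) by (metis ImageI prod.collapse subsetD)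
  moreover have "snd e \<in> set (pawalk_verts (snd e) p)" by (cases p) (use e in \<open>auto simp: awalk_Cons_iff\<close>)
  ultimately show ?case using Cons.IH[OF e(3)] Cons.prems(3) by auto
qed

text \<open>A walk with all arcs off \<open>S\<close> is cut down to a path using some of these
  arcs. The hypothesis \<open>u \<notin> S\<close> covers the empty path, whose vertex is on no
  arc.\<close>

lemma apath_of_rtrancl:
  assumes "pair_graph G" "(u, v) \<in> (Restr (parcs G) (- S))\<^sup>*" "u \<in> pverts G" "u \<notin> S"
  shows "\<exists>p. pre_digraph.apath (with_proj G) u p v \<and> set (pawalk_verts u p) \<inter> S = {}"
proof -
  interpret pair_graph G by (rule assms(1))
  let ?R = "Restr (parcs G) (- S)"
  have "\<exists>p. awalk u p v \<and> set p \<subseteq> ?R"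
    using assms(2,3)
  proof (induction rule: converse_rtrancl_induct)
    case base
    then show ?case by (intro exI[of _ "[]"]) (simp add: awalk_Nil_iff)
  next
    case (step y z)
    then obtain p where p: "awalk z p v" "set p \<subseteq> ?R"
      using in_arcsD2 by auto
    then show ?case using step by (intro exI[of _ "(y, z) # p"]) (auto simp: awalk_Cons_iff)
  qed
  then obtain p where p: "awalk u p v" "set p \<subseteq> ?R" by blast
  let ?q = "awalk_to_apath p"
  have "set ?q \<subseteq> ?R" using awalk_to_apath_subset[OF p(1)] p(2) by blast
  moreover have "set (pawalk_verts w q) \<subseteq> insert w (fst ` set q \<union> snd ` set q)" for w :: 'a and q
    by (induction q arbitrary: w) auto
  ultimately have "set (pawalk_verts u ?q) \<inter> S = {}" using assms(4) by fastforce
  then show ?thesis using apath_awalk_to_apath[OF p(1)] by blast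
qed

text \<open>Forwards, the witness is what \<open>Q - Q'\<close> reaches off
  \<open>Q \<inter> Q'\<close>; backwards, a path between the two sides must leave \<open>A\<close>,
  hence meet the separator.\<close>

lemma separating_pair_iff_separated_by:
  assumes "pair_graph G" "Q \<subseteq> pverts G"
  shows "separating_pair G Q Q' \<longleftrightarrow>
    Q \<inter> Q' \<noteq> {} \<and> separated_by (parcs G) (Q \<inter> Q') (Q - Q') (Q' - Q)"
proof -
  let ?S = "Q \<inter> Q'"
  let ?R = "Restr (parcs G) (- ?S)"
  have "separated_by (parcs G) ?S (Q - Q') (Q' - Q)" if sep: "separating_pair G Q Q'"
    unfolding separated_by_def
  proof (intro exI conjI)
    let ?A = "?R\<^sup>* `` (Q - Q')"
    show "Q - Q' \<subseteq> ?A" by auto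
    have "?A \<subseteq> - ?S" using Restr_rtrancl_mem by fastforce
    moreover have "?A \<inter> (Q' - Q) = {}"
    proof (rule ccontr)
      assume "?A \<inter> (Q' - Q) \<noteq> {}"
      then obtain u v where uv: "u \<in> Q - Q'" "v \<in> Q' - Q" "(u, v) \<in> ?R\<^sup>*" by blast
      then obtain p where "pre_digraph.apath (with_proj G) u p v"
        "set (pawalk_verts u p) \<inter> ?S = {}"
        using apath_of_rtrancl[OF assms(1), of u v ?S] assms(2) by blast
      then show False using sep uv unfolding separating_pair_def by blast
    qed
    ultimately show "?A \<inter> (?S \<union> (Q' - Q)) = {}" by blast
    show "parcs G `` ?A \<subseteq> ?A \<union> ?S"
    proof
      fix z assume "z \<in> parcs G `` ?A"
      then obtain x y where xy: "x \<in> Q - Q'" "(x, y) \<in> ?R\<^sup>*" "(y, z) \<in> parcs G" by blast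
      then have "y \<in> - ?S" using Restr_rtrancl_mem[OF xy(2)] by blast
      then show "z \<in> ?A \<union> ?S" using xy by (auto intro: rtrancl_into_rtrancl)
    qed
  qed
  moreover have "separating_pair G Q Q'"
    if ne: "?S \<noteq> {}" and sep: "separated_by (parcs G) ?S (Q - Q') (Q' - Q)"
  proof -
    obtain A where A: "Q - Q' \<subseteq> A" "A \<inter> (?S \<union> (Q' - Q)) = {}" "parcs G `` A \<subseteq> A \<union> ?S"
      using sep unfolding separated_by_def by blast
    show ?thesis
      unfolding separating_pair_def
      using ne A awalk_leaving_meets_separator[OF assms(1) _ A(3)] by (fastforce simp: pre_digraph.apath_def)
  qed
  ultimately show ?thesis unfolding separating_pair_def by blast
qed

text \<open>A clique cannot meet both sides of a separation: \<open>K\<close> misses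
  \<open>A\<close> or lies in \<open>A \<union> S\<close>, and \<open>v\<close> is put on the
  matching side.\<close>

lemma separated_by_insert_simplicial:
  assumes "separated_by E' S X Y" "complete_on E' K" "v \<notin> S" "v \<notin> X" "v \<notin> Y"
    and "E \<subseteq> E' \<union> {v} \<times> K \<union> K \<times> {v}"
    and "E' \<subseteq> (- {v}) \<times> (- {v})"
  shows "separated_by E S X Y"
proof -
  obtain A0 where A0: "X \<subseteq> A0" "A0 \<inter> (S \<union> Y) = {}" "E' `` A0 \<subseteq> A0 \<union> S"
    using assms(1) unfolding separated_by_def by blast
  \<comment> \<open>Nothing keeps \<open>v\<close> out of \<open>A0\<close>; as \<open>v\<close> is
    on no arc of \<open>E'\<close>, it can be removed.\<close>
  define A where "A = A0 - {v}"
  have A: "X \<subseteq> A" "A \<inter> (S \<union> Y) = {}" "E' `` A \<subseteq> A \<union> S" "v \<notin> A"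
    using A0 assms(4,7) by (auto simp: A_def)
  show ?thesis
  proof (cases "K \<inter> A = {}")
    case True
    then have "E `` A \<subseteq> A \<union> S" using A assms(6) by blast
    then show ?thesis using A unfolding separated_by_def by blast
  next
    case False
    then obtain a where "a \<in> K" "a \<in> A" by blast
    have "K \<subseteq> insert a (E' `` A)"
    proof
      fix z assume "z \<in> K"
      then have "z = a \<or> (a, z) \<in> E'" using assms(2) \<open>a \<in> K\<close> unfolding pairwise_def by metis
      then show "z \<in> insert a (E' `` A)" using \<open>a \<in> A\<close> by blast
    qed
    then have "K \<subseteq> A \<union> S" using A(3) \<open>a \<in> A\<close> by auto
    then have "E `` insert v A \<subseteq> insert v A \<union> S" using A assms(6,7) by blast
    moreover have "X \<subseteq> insert v A" "insert v A \<inter> (S \<union> Y) = {}" using A assms by auto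
    ultimately show ?thesis unfolding separated_by_def by blast
  qed
qed

section \<open>Cliques and separators of k-trees\<close>

lemma complete_digraph_parcs:
  assumes "complete_digraph n (with_proj G)"
  shows "parcs G = {(u, v). u \<in> pverts G \<and> v \<in> pverts G \<and> u \<noteq> v}" "card (pverts G) = n"
    "finite (pverts G)"
  using assms unfolding complete_digraph_pair_def by auto

lemma k_tree_wf: "k_tree k G \<Longrightarrow> parcs G \<subseteq> pverts G \<times> pverts G"
  using pair_graph_k_tree by (fastforce simp: pair_graph_def pair_digraph_def
    pair_fin_digraph_def pair_wf_digraph_def)

lemma k_tree_finite: "k_tree k G \<Longrightarrow> finite (pverts G)"
  using pair_graph_k_tree by (auto simp: pair_graph_def pair_digraph_def
    pair_fin_digraph_def pair_fin_digraph_axioms_def)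

lemma clique_add_vertex:
  assumes "parcs G \<subseteq> pverts G \<times> pverts G" "clique G K" "v \<notin> pverts G"
  shows "clique \<lparr> pverts = insert v (pverts G), parcs = parcs G \<union> {v} \<times> K \<union> K \<times> {v} \<rparr> Q \<longleftrightarrow>
    (if v \<in> Q then Q \<subseteq> insert v K else clique G Q)"
proof -
  show ?thesis
  proof (cases "v \<in> Q")
    case True
    have "u \<in> insert v K" if "clique \<lparr> pverts = insert v (pverts G),
        parcs = parcs G \<union> {v} \<times> K \<union> K \<times> {v} \<rparr> Q" "u \<in> Q" for u
      using that True assms unfolding clique_def pairwise_def by auto
    moreover have "clique \<lparr> pverts = insert v (pverts G),
        parcs = parcs G \<union> {v} \<times> K \<union> K \<times> {v} \<rparr> Q" if "Q \<subseteq> insert v K"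
    proof -
      have "(x, y) \<in> parcs G \<union> {v} \<times> K \<union> K \<times> {v}" if "x \<in> Q" "y \<in> Q" "x \<noteq> y" for x y
        using that \<open>Q \<subseteq> insert v K\<close> assms(2) unfolding clique_def pairwise_def by blast
      moreover have "Q \<subseteq> insert v (pverts G)" using that assms(2) by (auto simp: clique_def)
      ultimately show ?thesis unfolding clique_def pairwise_def by simp
    qed
    ultimately show ?thesis using True by auto
  next
    case False
    then show ?thesis using assms unfolding clique_def pairwise_def by auto
  qed
qed

lemma k_tree_clique_card_le:
  assumes "k_tree k G" "clique G Q"
  shows "card Q \<le> k + 1"
  using assms
proof (induction arbitrary: Q rule: k_tree.induct)
  case (complete G)
  then show ?case using complete_digraph_parcs[OF complete(1)]
    by (metis card_mono clique_def)
next
  case (add_vertex G K v)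
  have "finite K" using add_vertex.hyps k_tree_finite by (metis clique_def finite_subset)
  then have "card R \<le> k + 1" if "R \<subseteq> insert v K" for R
    using card_mono[OF _ that] add_vertex.hyps(3) card_insert_le_m1[of "k + 1" K v] by auto
  then show ?case using add_vertex clique_add_vertex[OF k_tree_wf[OF add_vertex.hyps(1)]]
    by (metis (full_types))
qed

text \<open>A clique through the new vertex \<open>v\<close> extends to \<open>insert v K\<close>;
  the others are old cliques.\<close>

lemma k_tree_clique_extend:
  assumes "k_tree k G" "clique G Q"
  shows "\<exists>R. Q \<subseteq> R \<and> clique G R \<and> card R = k + 1"
  using assms
proof (induction arbitrary: Q rule: k_tree.induct)
  case (complete G)
  then show ?case using complete_digraph_parcs[OF complete(1)]
    by (intro exI[of _ "pverts G"]) (auto simp: clique_def pairwise_def)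
next
  case (add_vertex G K v)
  note iff = clique_add_vertex[OF k_tree_wf[OF add_vertex.hyps(1)] add_vertex.hyps(2,4)]
  show ?case
  proof (cases "v \<in> Q")
    case True
    have "finite K" "v \<notin> K" using add_vertex.hyps k_tree_finite
      by (metis clique_def finite_subset, auto simp: clique_def)
    then have "card (insert v K) = k + 1" using add_vertex.hyps by simp
    then show ?thesis using True add_vertex.prems by (intro exI[of _ "insert v K"]) (simp add: iff)
  next
    case False
    then obtain R where R: "Q \<subseteq> R" "clique G R" "card R = k + 1"
      using add_vertex.IH add_vertex.prems by (auto simp: iff)
    moreover have "v \<notin> R" using R add_vertex.hyps by (auto simp: clique_def)
    ultimately show ?thesis by (intro exI[of _ R]) (simp add: iff)
  qed
qed

lemma k_tree_maximal_clique_iff: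
  assumes "k_tree k G"
  shows "maximal_clique G Q \<longleftrightarrow> clique G Q \<and> card Q = k + 1"
proof
  assume "maximal_clique G Q"
  then show "clique G Q \<and> card Q = k + 1"
    using k_tree_clique_extend[OF assms] unfolding maximal_clique_def by metis
next
  assume Q: "clique G Q \<and> card Q = k + 1"
  have "R = Q" if "clique G R" "Q \<subseteq> R" for R
  proof (rule sym, rule card_seteq)
    show "finite R" using that k_tree_finite[OF assms] by (metis clique_def finite_subset)
    show "card R \<le> card Q" using k_tree_clique_card_le[OF assms that(1)] Q by simp
  qed (rule that)
  then show "maximal_clique G Q" using Q unfolding maximal_clique_def by blast
qed

text \<open>In a complete graph no such \<open>a\<close> and \<open>b\<close> exist. When
  \<open>v\<close> is attached to \<open>K\<close>, either \<open>K \<subseteq> S\<close> gives the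
  bound, or some \<open>z \<in> K - S\<close> is on the same side as \<open>v\<close> and replaces
  it.\<close>

lemma k_tree_separator_card_ge:
  assumes "k_tree k G" "parcs G `` A \<subseteq> A \<union> S" "a \<in> pverts G" "a \<in> A - S"
    "b \<in> pverts G" "b \<notin> A \<union> S" "finite S"
  shows "k \<le> card S"
  using assms(1-6)
proof (induction arbitrary: a b rule: k_tree.induct)
  case (complete G)
  then have "(a, b) \<in> parcs G" using complete_digraph_parcs[OF complete(1)] by auto
  then show ?case using complete by blast
next
  case (add_vertex G K v)
  have KV: "K \<subseteq> pverts G" using add_vertex.hyps by (simp add: clique_def)
  have closed: "parcs G `` A \<subseteq> A \<union> S" and vK: "v \<in> A \<Longrightarrow> K \<subseteq> A \<union> S"
    and Kv: "K \<inter> A \<noteq> {} \<Longrightarrow> v \<in> A \<union> S"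
    using add_vertex.prems(1) by auto
  have ?case if "K \<subseteq> S" using card_mono[OF assms(7) that] add_vertex.hyps by simp
  moreover have ?case if nsub: "\<not> K \<subseteq> S"
  proof -
    obtain z where z: "z \<in> K" "z \<notin> S" using nsub by blast
    have zV: "z \<in> pverts G" using z KV by blast
    show ?thesis
    proof (cases "a = v")
      case True
      then show ?thesis using add_vertex.IH[OF closed, of z b] add_vertex.prems z zV vK by auto
    next
      case False
      show ?thesis
      proof (cases "b = v")
        case True
        then show ?thesis
          using add_vertex.IH[OF closed, of a z] add_vertex.prems z zV Kv False by auto
      next
        case bv: False
        then show ?thesis using add_vertex.IH[OF closed, of a b] add_vertex.prems False by auto
      qed
    qed
  qed
  ultimately show ?case by blast
qed

text \<open>If the new vertex \<open>v\<close> is \<open>a\<close> or \<open>b\<close>, then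
  \<open>S\<close> is its whole neighbourhood \<open>K\<close>. If \<open>v \<in> S\<close>, then
  \<open>K\<close> would have \<open>k + 1\<close> elements. Otherwise the separation in the old
  graph survives the attachment of \<open>v\<close> to a clique.\<close>

lemma k_tree_separated_by_clique:
  assumes "k_tree k G" "clique G S" "card S = k" "clique G (insert a S)" "clique G (insert b S)"
    "a \<notin> S" "b \<notin> S" "a \<noteq> b"
  shows "separated_by (parcs G) S {a} {b}"
  using assms
proof (induction arbitrary: S a b rule: k_tree.induct)
  case (complete G)
  have "insert a (insert b S) \<subseteq> pverts G" using complete.prems by (auto simp: clique_def)
  moreover have "finite S" using complete.prems complete_digraph_parcs(3)[OF complete.hyps]
    by (metis clique_def finite_subset)
  ultimately have "card (insert a (insert b S)) \<le> k + 1"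
    using complete_digraph_parcs[OF complete.hyps] by (metis card_mono)
  then show ?case using complete.prems \<open>finite S\<close> by simp
next
  case (add_vertex G K v)
  note wf = k_tree_wf[OF add_vertex.hyps(1)]
  note iff = clique_add_vertex[OF wf add_vertex.hyps(2,4)]
  have KV: "K \<subseteq> pverts G" using add_vertex.hyps by (simp add: clique_def)
  then have K: "v \<notin> K" "finite K"
    using add_vertex.hyps k_tree_finite finite_subset by blast+
  let ?E = "parcs G \<union> {v} \<times> K \<union> K \<times> {v}"
  have adj: "T = K" if "insert v T \<subseteq> insert v K" "card T = k" "v \<notin> T" for T
    using that K add_vertex.hyps(3) by (intro card_seteq) auto
  have closed: "?E `` {v} \<subseteq> K" using wf add_vertex.hyps K by auto
  show ?case
  proof (cases "v \<in> S")
    case True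
    then have S: "insert a (insert b S) - {v} \<subseteq> K"
      using add_vertex.prems unfolding iff by auto
    have "finite S" using add_vertex.prems True K unfolding iff by (meson finite_insert finite_subset)
    have "card (insert a (insert b S) - {v}) = k + 1"
      using add_vertex.prems True \<open>finite S\<close> by simp
    then show ?thesis using card_mono[OF K(2) S] add_vertex.hyps by simp
  next
    case vS: False
    consider "a = v" | "b = v" | "a \<noteq> v" "b \<noteq> v" by blast
    then show ?thesis
    proof cases
      case 1
      then have "S = K" using add_vertex.prems vS adj unfolding iff by simp
      then show ?thesis using 1 closed add_vertex.prems K unfolding separated_by_def
        by (intro exI[of _ "{v}"]) auto
    next
      case 2
      then have "S = K" using add_vertex.prems vS adj unfolding iff by simp
      \<comment> \<open>The witness must contain \<open>a\<close>, so it is the old graph without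
        \<open>K\<close>, none of whose vertices is adjacent to \<open>v\<close>.\<close>
      then show ?thesis using 2 wf add_vertex.hyps add_vertex.prems K KV unfolding separated_by_def
        by (intro exI[of _ "pverts G - K"]) (auto simp: iff clique_def)
    next
      case 3
      then have "separated_by (parcs G) S {a} {b}"
        using add_vertex.prems vS by (intro add_vertex.IH) (auto simp: iff)
      then show ?thesis
        using 3 vS wf add_vertex.hyps K
        by (simp, elim separated_by_insert_simplicial[where K = K and v = v])
          (auto simp: clique_def)
    qed
  qed
qed

text \<open>Distinct (k+1)-cliques share at most \<open>k\<close> vertices and separators have at
  least \<open>k\<close>. Conversely, cliques sharing \<open>k\<close> vertices leave one vertex on
  each side, and the shared clique separates these two.\<close>

lemma k_tree_imp_graphs_eq:
  assumes "k_tree k G" "1 \<le> k"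
  shows "reduced_clique_graph G = line_graph (k + 1) G"
proof -
  note maximal = k_tree_maximal_clique_iff[OF assms(1)]
  have "(Q \<noteq> R \<and> separating_pair G Q R) \<longleftrightarrow> card (Q \<inter> R) = k"
    if Q: "clique G Q" "card Q = k + 1" and R: "clique G R" "card R = k + 1" for Q R
  proof -
    have QV: "Q \<subseteq> pverts G" "R \<subseteq> pverts G" using Q R by (auto simp: clique_def)
    have fin: "finite Q" "finite R" using QV k_tree_finite[OF assms(1)] finite_subset by blast+
    note sep_iff = separating_pair_iff_separated_by[OF pair_graph_k_tree[OF assms(1)] QV(1)]
    show ?thesis
    proof
      assume qr: "Q \<noteq> R \<and> separating_pair G Q R"
      then obtain A where A: "Q - R \<subseteq> A" "A \<inter> (Q \<inter> R \<union> (R - Q)) = {}"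
        "parcs G `` A \<subseteq> A \<union> (Q \<inter> R)"
        unfolding sep_iff separated_by_def by blast
      have nsub: "\<not> Q \<subseteq> R" "\<not> R \<subseteq> Q" using qr Q R fin card_subset_eq by metis+
      then obtain a b where ab: "a \<in> Q - R" "b \<in> R - Q" by blast
      have "k \<le> card (Q \<inter> R)"
        by (rule k_tree_separator_card_ge[OF assms(1) A(3), of a b]) (use ab A QV fin in auto)
      moreover have "card (Q \<inter> R) < card Q" using nsub fin by (intro psubset_card_mono) auto
      ultimately show "card (Q \<inter> R) = k" using Q by simp
    next
      assume c: "card (Q \<inter> R) = k"
      have "card (Q - R) = 1" "card (R - Q) = 1"
        using c Q R fin card_Diff_subset_Int[of Q R] card_Diff_subset_Int[of R Q]
        by (auto simp: Int_commute)
      then obtain a b where ab: "Q - R = {a}" "R - Q = {b}" by (auto simp: card_1_singleton_iff)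
      have eq: "insert a (Q \<inter> R) = Q" "insert b (Q \<inter> R) = R" using ab by auto
      have "separated_by (parcs G) (Q \<inter> R) {a} {b}"
        by (rule k_tree_separated_by_clique[OF assms(1) _ c])
          (use Q(1) R(1) ab in \<open>simp_all add: eq\<close>, auto simp: clique_def pairwise_def)
      moreover have "Q \<inter> R \<noteq> {}" using c assms(2) by auto
      ultimately show "Q \<noteq> R \<and> separating_pair G Q R" using ab unfolding sep_iff by auto
    qed
  qed
  then show ?thesis unfolding reduced_clique_graph_def line_graph_def maximal by auto
qed

section \<open>Building a k-tree by removing simplicial vertices\<close>

text \<open>A passage through \<open>v\<close> is replaced by the edge between the neighbours before
  and after it.\<close>

lemma connected_remove_simplicial:
  assumes "sym E" "(x, y) \<in> (Restr E V)\<^sup>*" "x \<noteq> v" "y \<noteq> v"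
    "complete_on E (E `` {v} \<inter> V)" "irrefl E"
  shows "(x, y) \<in> (Restr E (V - {v}))\<^sup>*"
proof -
  let ?R = "Restr E (V - {v})" and ?N = "E `` {v} \<inter> V"
  note sym = symD[OF assms(1)]
  have vN: "v \<notin> ?N" using irreflD[OF assms(6)] by auto
  \<comment> \<open>When the walk is at \<open>v\<close>, the invariant already supplies every
    possible next vertex.\<close>
  have "if y = v then \<forall>n\<in>?N. (x, n) \<in> ?R\<^sup>* else (x, y) \<in> ?R\<^sup>*"
    using assms(2)
  proof (induction rule: rtrancl_induct)
    case base
    then show ?case using assms(3) by simp
  next
    case (step y z)
    show ?case
    proof (cases "z = v")
      case True
      then have y: "y \<noteq> v" "y \<in> ?N" using step.hyps irreflD[OF assms(6)] sym by auto
      then have xy: "(x, y) \<in> ?R\<^sup>*" using step.IH by simp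
      have "(x, n) \<in> ?R\<^sup>*" if n: "n \<in> ?N" for n
      proof (cases "n = y")
        case False
        then have "(y, n) \<in> E" using pairwiseD[OF assms(5) y(2) n] by simp
        then have "(y, n) \<in> ?R" using y n vN by blast
        then show ?thesis using xy by (rule rtrancl_into_rtrancl[rotated])
      qed (use xy in simp)
      then show ?thesis using True by simp
    next
      case False
      show ?thesis
      proof (cases "y = v")
        case True
        then show ?thesis using False step by auto
      next
        case yv: False
        then have "(y, z) \<in> ?R" using False step.hyps by auto
        moreover have "(x, y) \<in> ?R\<^sup>*" using step.IH yv by simp
        ultimately show ?thesis using False by (auto intro: rtrancl_into_rtrancl)
      qed
    qed
  qed
  then show ?thesis using assms(4) by simp
qed

text \<open>\<open>S\<close> is the set of attachments of a component \<open>C\<close> of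
  \<open>V - Q\<close>, and \<open>c \<in> C\<close> dominates it. A clique through \<open>c\<close>
  stays in \<open>C \<union> S\<close>, so it meets \<open>Q\<close> within \<open>S\<close>.
  Leaving \<open>R\<close> free allows a later choice of a (k+1)-clique.\<close>

lemma separated_neighbour_clique:
  assumes "chordal_rel E" "sym E" "finite V"
    and conn: "\<And>x y. x \<in> V \<Longrightarrow> y \<in> V \<Longrightarrow> (x, y) \<in> (Restr E V)\<^sup>*"
    and Q: "Q \<subseteq> V" "complete_on E Q" "Q \<noteq> {}" "Q \<noteq> V"
  obtains S c where "S \<subseteq> Q" "S \<noteq> {}" "c \<in> V - Q" "\<And>s. s \<in> S \<Longrightarrow> (c, s) \<in> E"
    "\<And>R. R \<subseteq> V \<Longrightarrow> complete_on E R \<Longrightarrow> insert c S \<subseteq> R \<Longrightarrow>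
      Q \<inter> R = S \<and> separated_by (Restr E V) S (Q - R) (R - Q)"
proof -
  note sym = symD[OF assms(2)]
  obtain y where y: "y \<in> V - Q" using Q by blast
  define C where "C = (Restr E (V - Q))\<^sup>* `` {y}"
  have yC: "y \<in> C" by (simp add: C_def)
  have CV: "C \<subseteq> V - Q" using y Restr_rtrancl_mem unfolding C_def by fastforce
  define S where "S = Q \<inter> E `` C"
  have nbr: "E `` C \<inter> V \<subseteq> C \<union> S"
  proof
    fix z assume "z \<in> E `` C \<inter> V"
    then obtain c where c: "c \<in> C" "(c, z) \<in> E" "z \<in> V" by blast
    show "z \<in> C \<union> S"
    proof (cases "z \<in> Q")
      case True
      then show ?thesis using c by (auto simp: S_def)
    next
      case False
      then have "(c, z) \<in> Restr E (V - Q)" using c CV by auto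
      then show ?thesis using c(1) by (auto simp: C_def intro: rtrancl_into_rtrancl)
    qed
  qed
  have "S \<noteq> {}"
  proof -
    obtain q where q: "q \<in> Q" using Q by blast
    then have "(y, q) \<in> (Restr E V)\<^sup>*" using conn y Q by blast
    \<comment> \<open>A walk from \<open>y\<close> to \<open>Q\<close> has to leave
      \<open>C\<close>, and it can do so only into \<open>S\<close>.\<close>
    then obtain e f where "e \<in> C" "(e, f) \<in> Restr E V" "f \<notin> C"
      using first_entry[of y q "Restr E V" "- C"] yC q CV by blast
    then show ?thesis using nbr by blast
  qed
  have "\<exists>c\<in>C. \<forall>s\<in>S. (c, s) \<in> E"
  proof (rule dominating_vertex[OF assms(1,2)])
    show "finite S" using assms(3) Q finite_subset unfolding S_def by blast
    show "complete_on E S" using Q unfolding S_def by (auto intro: pairwise_subset)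
    show "E `` {s} \<inter> C \<noteq> {}" if "s \<in> S" for s using that sym by (auto simp: S_def)
  qed (use reachable_connected[OF assms(2) C_def] yC CV in \<open>auto simp: S_def\<close>)
  then obtain c where c: "c \<in> C" "\<And>s. s \<in> S \<Longrightarrow> (c, s) \<in> E" by blast
  show thesis
  proof (rule that[of S c])
    fix R assume R: "R \<subseteq> V" "complete_on E R" "insert c S \<subseteq> R"
    have RCS: "R \<subseteq> C \<union> S"
    proof
      fix r assume "r \<in> R"
      then have "r = c \<or> (c, r) \<in> E" using R by (auto simp: pairwise_def)
      then show "r \<in> C \<union> S" using nbr c(1) \<open>r \<in> R\<close> R by blast
    qed
    have "Q \<inter> R = S" using RCS CV R by (auto simp: S_def)
    moreover have "separated_by (Restr E V) S (Q - R) (R - Q)"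
      unfolding separated_by_def
    \<comment> \<open>The witness is everything beyond \<open>S\<close> as seen from
      \<open>C\<close>; by symmetry no edge leads from it into \<open>C\<close>.\<close>
    proof (intro exI[of _ "V - C - S"] conjI)
      show "Q - R \<subseteq> V - C - S" using Q CV R by auto
      show "(V - C - S) \<inter> (S \<union> (R - Q)) = {}" using RCS by auto
      show "Restr E V `` (V - C - S) \<subseteq> V - C - S \<union> S" using nbr sym by blast
    qed
    ultimately show "Q \<inter> R = S \<and> separated_by (Restr E V) S (Q - R) (R - Q)" by blast
  qed (use \<open>S \<noteq> {}\<close> c CV in \<open>auto simp: S_def\<close>)
qed

text \<open>The relation \<open>E\<close> stays fixed while \<open>V\<close> loses a simplicial
  vertex \<open>v\<close>, so only the hypotheses on \<open>V\<close> must be transferred to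
  \<open>V - {v}\<close>.\<close>

lemma k_treeI:
  assumes "chordal_rel E" "sym E" "irrefl E" "1 \<le> k"
    and "finite V" "V \<noteq> {}"
    and "\<And>x y. x \<in> V \<Longrightarrow> y \<in> V \<Longrightarrow> (x, y) \<in> (Restr E V)\<^sup>*"
    and "\<And>Q. Q \<subseteq> V \<Longrightarrow> complete_on E Q \<Longrightarrow> card Q \<le> k + 1"
    and "\<And>Q. Q \<subseteq> V \<Longrightarrow> complete_on E Q \<Longrightarrow>
      \<exists>R. Q \<subseteq> R \<and> R \<subseteq> V \<and> complete_on E R \<and> card R = k + 1"
    and "\<And>Q R. Q \<subseteq> V \<Longrightarrow> R \<subseteq> V \<Longrightarrow> complete_on E Q \<Longrightarrow> complete_on E R \<Longrightarrow>
      card Q = k + 1 \<Longrightarrow> card R = k + 1 \<Longrightarrow> Q \<noteq> R \<Longrightarrow> Q \<inter> R \<noteq> {} \<Longrightarrow>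
      separated_by (Restr E V) (Q \<inter> R) (Q - R) (R - Q) \<Longrightarrow> card (Q \<inter> R) = k"
  shows "k_tree k \<lparr> pverts = V, parcs = Restr E V \<rparr>"
  using assms(5-)
proof (induction "card V" arbitrary: V rule: less_induct)
  case less
  note fin = less.prems(1) and conn = less.prems(3) and small = less.prems(4)
    and extend = less.prems(5) and sep = less.prems(6)
  note sym = symD[OF assms(2)] and irrefl = irreflD[OF assms(3)]
  show ?case
  proof (cases "complete_on E V")
    case True
    then have "card V = k + 1" using small[of V] extend[of V] by (metis order_refl subset_antisym)
    moreover have "Restr E V = {(u, v). u \<in> V \<and> v \<in> V \<and> u \<noteq> v}"
      using True irrefl by (auto simp: pairwise_def)
    ultimately show ?thesis using fin
      by (intro k_tree.complete) (auto simp: complete_digraph_pair_def)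
  next
    case False
    then obtain x y where "x \<in> V" "y \<in> V" "y \<noteq> x" "(x, y) \<notin> E" by (auto simp: pairwise_def)
    then obtain v where v: "v \<in> V" and N: "complete_on E (E `` {v} \<inter> V)"
      using simplicial_vertex_off_neighbourhood[OF fin assms(1-3)] by blast
    define N where "N = E `` {v} \<inter> V"
    define Q where "Q = insert v N"
    note N = N[folded N_def]
    have vN: "v \<notin> N" "N \<subseteq> V" using irrefl by (auto simp: N_def)
    have finN: "finite N" using fin vN finite_subset by blast
    have Q: "Q \<subseteq> V" "complete_on E Q" "Q \<noteq> {}"
      using v vN N sym by (auto simp: Q_def N_def pairwise_insert)
    have in_Q: "R \<subseteq> Q" if "R \<subseteq> V" "complete_on E R" "v \<in> R" for R
      using that by (auto simp: Q_def N_def pairwise_def)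
    \<comment> \<open>Every clique through \<open>v\<close> lies in \<open>Q\<close>, so a
      (k+1)-clique extending \<open>Q\<close> is \<open>Q\<close> itself.\<close>
    have cardQ: "card Q = k + 1"
    proof -
      obtain R where R: "Q \<subseteq> R" "R \<subseteq> V" "complete_on E R" "card R = k + 1"
        using extend[OF Q(1,2)] by blast
      then have "R = Q" using in_Q[of R] by (auto simp: Q_def)
      then show ?thesis using R by simp
    qed
    then have cardN: "card N = k" using vN finN by (simp add: Q_def)
    have "Q \<noteq> V" using False Q by blast
    obtain S c where S: "S \<subseteq> Q" "S \<noteq> {}" "c \<in> V - Q" "\<And>s. s \<in> S \<Longrightarrow> (c, s) \<in> E"
      and S_sep: "\<And>R. R \<subseteq> V \<Longrightarrow> complete_on E R \<Longrightarrow> insert c S \<subseteq> R \<Longrightarrow>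
        Q \<inter> R = S \<and> separated_by (Restr E V) S (Q - R) (R - Q)"
      using separated_neighbour_clique[OF assms(1,2) fin conn Q \<open>Q \<noteq> V\<close>] by metis
    have "complete_on E (insert c S)"
      using S Q sym by (auto simp: pairwise_insert intro: pairwise_subset)
    then obtain R where R: "insert c S \<subseteq> R" "R \<subseteq> V" "complete_on E R" "card R = k + 1"
      using extend[of "insert c S"] S Q by auto
    have QR: "Q \<inter> R = S" "separated_by (Restr E V) S (Q - R) (R - Q)"
      using S_sep R by auto
    have vR: "v \<notin> R" using in_Q[OF R(2,3)] R(1) S(3) by blast
    have "card S = k" using sep[of Q R] Q R cardQ QR S by (metis DiffD2 insert_subset)
    \<comment> \<open>As \<open>v \<notin> R\<close>, \<open>S\<close> lies in \<open>N\<close>, and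
      both have \<open>k\<close> elements.\<close>
    then have "S = N" using S(1) QR(1) vR finN cardN
      by (intro card_seteq) (auto simp: Q_def)
    then have NR: "N \<subseteq> R" using QR by blast
    let ?V = "V - {v}" and ?E = "Restr E (V - {v})"
    have eq: "Restr E V = ?E \<union> {v} \<times> N \<union> N \<times> {v}"
      using v sym irrefl by (auto simp: N_def)
    have "k_tree k \<lparr> pverts = ?V, parcs = ?E \<rparr>"
    proof (rule less.hyps)
      show "card ?V < card V" using v fin by (rule card_Diff1_less[rotated])
      show "finite ?V" using fin by simp
      show "?V \<noteq> {}" using S(3) Q_def by auto
      show "(x, y) \<in> ?E\<^sup>*" if "x \<in> ?V" "y \<in> ?V" for x y
        using that connected_remove_simplicial[OF assms(2) conn] N assms(3) by (simp add: N_def)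
      show "card P \<le> k + 1" if "P \<subseteq> ?V" "complete_on E P" for P using small[of P] that by blast
      show "\<exists>R. P \<subseteq> R \<and> R \<subseteq> ?V \<and> complete_on E R \<and> card R = k + 1"
        if P: "P \<subseteq> ?V" "complete_on E P" for P
      proof -
        obtain T where T: "P \<subseteq> T" "T \<subseteq> V" "complete_on E T" "card T = k + 1"
          using extend[of P] P by blast
        show ?thesis
        proof (cases "v \<in> T")
          case True
          \<comment> \<open>Here \<open>P \<subseteq> N\<close>, so \<open>R\<close>, which contains
            \<open>N\<close> and avoids \<open>v\<close>, extends \<open>P\<close> in place of
            \<open>T\<close>.\<close>
          then have "T \<subseteq> insert v N" using in_Q[OF T(2,3)] by (simp add: Q_def)
          then have "P \<subseteq> R" using T(1) P(1) NR by blast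
          then show ?thesis using R vR by blast
        next
          case False
          then show ?thesis using T by blast
        qed
      qed
      fix P T assume PT: "P \<subseteq> ?V" "T \<subseteq> ?V" "complete_on E P" "complete_on E T"
        "card P = k + 1" "card T = k + 1" "P \<noteq> T" "P \<inter> T \<noteq> {}"
        "separated_by ?E (P \<inter> T) (P - T) (T - P)"
      \<comment> \<open>Adding \<open>v\<close> back along the clique \<open>N\<close> preserves the
        separation, so the hypothesis for \<open>V\<close> applies.\<close>
      have "separated_by (Restr E V) (P \<inter> T) (P - T) (T - P)"
        by (rule separated_by_insert_simplicial[OF PT(9), where K = N and v = v])
          (use PT N vN eq in \<open>auto simp: pairwise_def\<close>)
      then show "card (P \<inter> T) = k" using sep[of P T] PT by blast
    qed
    then have "k_tree k \<lparr> pverts = insert v ?V, parcs = ?E \<union> {v} \<times> N \<union> N \<times> {v} \<rparr>"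
      using k_tree.add_vertex[of k "\<lparr> pverts = ?V, parcs = ?E \<rparr>" N v] N vN cardN
      by (auto simp: clique_def pairwise_def)
    then show ?thesis using eq v by (simp add: insert_absorb)
  qed
qed

section \<open>From equality of the two graphs to the k-tree\<close>

lemma clique_extend_maximal:
  assumes "pair_graph G" "clique G Q"
  shows "\<exists>R. Q \<subseteq> R \<and> maximal_clique G R"
  using finite_has_maximal2[OF finite_cliques[OF assms(1)], of Q] assms(2)
  unfolding maximal_clique_def by auto

text \<open>Equality of vertex sets makes the maximal cliques exactly the (k+1)-cliques; equality of
  edge sets makes separating pairs share \<open>k\<close> vertices. These are the hypotheses of
  \<open>k_treeI\<close>.\<close>

lemma graphs_eq_imp_k_tree:
  assumes "1 \<le> k" "pair_graph G" "Digraph_Component.connected (with_proj G)" "chordal G"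
    and eq: "reduced_clique_graph G = line_graph (k + 1) G"
  shows "k_tree k G"
proof -
  interpret pair_graph G by (rule assms(2))
  let ?V = "pverts G" and ?E = "parcs G"
  have Restr: "Restr ?E ?V = ?E" using in_arcsD1 in_arcsD2 by auto
  have clique: "clique G Q \<longleftrightarrow> Q \<subseteq> ?V \<and> complete_on ?E Q" for Q by (simp add: clique_def)
  have maximal: "maximal_clique G Q \<longleftrightarrow> clique G Q \<and> card Q = k + 1" for Q
    using arg_cong[OF eq, of pverts] by (auto simp: reduced_clique_graph_def line_graph_def)
  have arcs: "card (Q \<inter> R) = k"
    if "maximal_clique G Q" "maximal_clique G R" "Q \<noteq> R" "separating_pair G Q R" for Q R
  proof -
    have "(Q, R) \<in> parcs (line_graph (k + 1) G)"
      unfolding eq[symmetric] using that by (simp add: reduced_clique_graph_def)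
    then show ?thesis by (simp add: line_graph_def)
  qed
  have sym: "sym ?E" using arcs_symmetric by (auto intro: symI)
  have "k_tree k \<lparr> pverts = ?V, parcs = Restr ?E ?V \<rparr>"
  proof (rule k_treeI)
    show "chordal_rel ?E" using assms chordal_imp_chordal_rel by blast
    show "sym ?E" by (rule sym)
    show "irrefl ?E" using no_loops' by (metis irreflI)
    have sc: "strongly_connected (with_proj G)"
      using assms(3) pair_sym_arcs symmetric_connected_imp_strongly_connected by blast
    show "?V \<noteq> {}" using sc by (simp add: strongly_connected_def)
    show "(x, y) \<in> (Restr ?E ?V)\<^sup>*" if "x \<in> ?V" "y \<in> ?V" for x y
      using sc that unfolding Restr strongly_connected_def reachable_def
      by (auto dest: rtrancl_on_rtranclI)
    show "card Q \<le> k + 1" if "Q \<subseteq> ?V" "complete_on ?E Q" for Q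
    proof (rule ccontr)
      assume "\<not> card Q \<le> k + 1"
      \<comment> \<open>A larger clique would properly contain a (k+1)-clique, which is
        maximal.\<close>
      then obtain T where T: "T \<subseteq> Q" "card T = k + 1"
        by (meson nat_le_linear obtain_subset_with_card_n)
      then have "maximal_clique G T" using that maximal clique by (auto intro: pairwise_subset)
      then have "Q = T" using that clique T unfolding maximal_clique_def by blast
      then show False using T \<open>\<not> card Q \<le> k + 1\<close> by simp
    qed
    show "\<exists>R. Q \<subseteq> R \<and> R \<subseteq> ?V \<and> complete_on ?E R \<and> card R = k + 1"
      if "Q \<subseteq> ?V" "complete_on ?E Q" for Q
      using clique_extend_maximal[OF assms(2), of Q] that maximal clique by auto
    show "card (Q \<inter> R) = k" if "Q \<subseteq> ?V" "R \<subseteq> ?V" "complete_on ?E Q" "complete_on ?E R"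
      "card Q = k + 1" "card R = k + 1" "Q \<noteq> R" "Q \<inter> R \<noteq> {}"
      "separated_by (Restr ?E ?V) (Q \<inter> R) (Q - R) (R - Q)" for Q R
      using that arcs[of Q R] maximal clique
        separating_pair_iff_separated_by[OF assms(2) that(1)] unfolding Restr by auto
  qed (use assms pair_finite_verts in auto)
  moreover have "\<lparr> pverts = ?V, parcs = ?E \<rparr> = G" by simp
  ultimately show ?thesis unfolding Restr by simp
qed

theorem theorem6:
  fixes G :: "'a pair_pre_digraph" and k :: nat
  assumes "1 \<le> k"
    and "pair_graph G"
    and "Digraph_Component.connected (with_proj G)"
    and "chordal G"
  shows "k_tree k G \<longleftrightarrow> reduced_clique_graph G = line_graph (k + 1) G"
  using k_tree_imp_graphs_eq graphs_eq_imp_k_tree assms by blast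

end
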